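(* Let $p\in[2,\infty)$ and $s\in(0,1)$. There exists a constant $C=C(N,p,s)$ such that whenever $u\in L^{p-1}_{sp}(\mathbb{R}^N)$, $x_o\in\mathbb{R}^N$, $R>0$, $r\in(0,R)$, and $d\in(0,\frac14(R-r)]$, we have for any $h\in\mathbb{R}^N\setminus\{0\}$ with $0<|h|\le d$ and (almost) any $x\in B_{\frac12(R+r)}(x_o)$ that \begin{align*} \bigg|\int_{\mathbb{R}^N\setminus B_R(x_o)}&\frac{V_{p-1}(u_h(x)-u_h(y))-V_{p-1}(u(x)-u(y))}{|x-y|^{N+sp}}\,dy\bigg|\\ &\le C\frac{|\tau_hu(x)|}{R^{sp}}\Big(\frac R{R-r}\Big)^{N+sp}\mathcal T^{p-2}+C\frac{|h|}{R^{sp+1}}\Big(\frac R{R-r}\Big)^{N+sp+1}\mathcal T^{p-1}, \end{align*} where $$\mathcal T:=\|u\|_{L^\infty(B_{R+d}(x_o))}+\mathrm{Tail}(u;x_o,R+d).$$ In addition, the constant $C$ has the form $C=\widetilde C(N,p)/s$.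
   Context: $N\ge2$. $B_R(x_o)\subset\mathbb{R}^N$ is the ball of radius $R$ and center $x_o$. $u_h(x):=u(x+h)$ and $\tau_hu(x):=u(x+h)-u(x)$. For $\gamma>0$ and $a\in\mathbb{R}$, $V_\gamma(a):=|a|^{\gamma-1}a$ (with $V_\gamma(0)=0$). When $p=2$, $\mathcal T^{p-2}$ is interpreted as $1$. If $u$ is not essentially bounded on $B_{R+d}(x_o)$ the right-hand side is $+\infty$. $L^{p-1}_{sp}(\mathbb{R}^N)$ is the set of $w\in L^{p-1}_{\rm loc}(\mathbb{R}^N)$ with $\int_{\mathbb{R}^N}\frac{|w(x)|^{p-1}}{(1+|x|)^{N+sp}}\,dx<\infty$, and $\mathrm{Tail}(u;x_o,\varrho):=\big[\varrho^{sp}\int_{\mathbb{R}^N\setminus B_\varrho(x_o)}\frac{|u(x)|^{p-1}}{|x-x_o|^{N+sp}}\,dx\big]^{\frac1{p-1}}$. *)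

theory Defs
  imports "HOL-Analysis.Analysis" "HOL-Probability.Essential_Supremum"
begin

definition shift :: "real ^ 'n \<Rightarrow> (real ^ 'n \<Rightarrow> real) \<Rightarrow> real ^ 'n \<Rightarrow> real" where
  "shift h u x = u (x + h)"

definition tau :: "real ^ 'n \<Rightarrow> (real ^ 'n \<Rightarrow> real) \<Rightarrow> real ^ 'n \<Rightarrow> real" where
  "tau h u x = u (x + h) - u x"

(* Since 0 powr b = 0 for every b, this gives V \<gamma> 0 = 0 also for \<gamma> = 1. *)
definition V :: "real \<Rightarrow> real \<Rightarrow> real" where
  "V \<gamma> a = \<bar>a\<bar> powr (\<gamma> - 1) * a"

(* Functions are pointwise-defined representatives; they are measurable
   with respect to the (complete) Lebesgue sigma-algebra. *)
definition L_loc :: "real \<Rightarrow> (real ^ 'n \<Rightarrow> real) set" where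
  "L_loc q = {w. w \<in> borel_measurable lebesgue \<and>
     (\<forall>K. compact K \<longrightarrow> set_integrable lebesgue K (\<lambda>x. \<bar>w x\<bar> powr q))}"

definition L_sp :: "real \<Rightarrow> real \<Rightarrow> (real ^ 'n \<Rightarrow> real) set" where
  "L_sp s p = {w \<in> L_loc (p - 1).
     (\<integral>\<^sup>+ x. ennreal (\<bar>w x\<bar> powr (p - 1) / (1 + norm x) powr (real CARD('n) + s * p)) \<partial>lebesgue) < \<infinity>}"

(* The integrand is integrable outside the ball for u \<in> L_sp s p and \<rho> > 0, so the
   Bochner integral does not take its default value 0 where it is used. *)
definition Tail :: "real \<Rightarrow> real \<Rightarrow> (real ^ 'n \<Rightarrow> real) \<Rightarrow> real ^ 'n \<Rightarrow> real \<Rightarrow> real" where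
  "Tail s p u xo \<rho> =
     (\<rho> powr (s * p) *
       (LINT x : - ball xo \<rho> | lebesgue.
          \<bar>u x\<bar> powr (p - 1) / norm (x - xo) powr (real CARD('n) + s * p)))
     powr (1 / (p - 1))"

definition Linf_norm :: "(real ^ 'n \<Rightarrow> real) \<Rightarrow> (real ^ 'n) set \<Rightarrow> ereal" where
  "Linf_norm u S = esssup (lebesgue_on S) (\<lambda>x. ereal \<bar>u x\<bar>)"

definition nonlocal_integrand ::
  "real \<Rightarrow> real \<Rightarrow> (real ^ 'n \<Rightarrow> real) \<Rightarrow> real ^ 'n \<Rightarrow> real ^ 'n \<Rightarrow> real ^ 'n \<Rightarrow> real" where
  "nonlocal_integrand s p u h x y =
     (V (p - 1) (shift h u x - shift h u y) - V (p - 1) (u x - u y))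
       / norm (x - y) powr (real CARD('n) + s * p)"

(* The value is \<infinity> when u is not essentially bounded on the ball of radius R + d; otherwise
   it is the real expression, where the power T^(p-2) is read as 1 for p = 2, also if T = 0. *)
definition nonlocal_bound ::
  "real \<Rightarrow> real \<Rightarrow> real \<Rightarrow> (real ^ 'n \<Rightarrow> real) \<Rightarrow> real ^ 'n \<Rightarrow> real \<Rightarrow> real \<Rightarrow> real \<Rightarrow>
   real ^ 'n \<Rightarrow> real ^ 'n \<Rightarrow> ereal" where
  "nonlocal_bound C s p u xo R r d h x =
     (if Linf_norm u (ball xo (R + d)) = \<infinity> then \<infinity>
      else
        (let T = real_of_ereal (Linf_norm u (ball xo (R + d))) + Tail s p u xo (R + d);
             T_pow = (if p = 2 then 1 else T powr (p - 2))
         in ereal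
           (C * (\<bar>tau h u x\<bar> / R powr (s * p))
              * (R / (R - r)) powr (real CARD('n) + s * p) * T_pow
          + C * (norm h / R powr (s * p + 1))
              * (R / (R - r)) powr (real CARD('n) + s * p + 1) * T powr (p - 1))))"

end

theory Submission
  imports Defs
begin

text \<open>
  The increment of the nonlocal integral has two causes: the value of \<open>u\<close> at the fixed point changes from
  \<open>u x\<close> to \<open>u (x + h)\<close>, and its value at the integration variable changes from \<open>u y\<close> to \<open>u (y + h)\<close>. They are
  treated one after the other.
  
  For the first, the local Lipschitz bound for \<open>V (p - 1)\<close> (\<open>V_diff_le\<close>) produces \<open>\<bar>tau h u x\<bar>\<close> times a
  power with exponent \<open>p - 2\<close>. For the second, \<open>u\<close> has no regularity, so the translation \<open>z = y + h\<close>
  turns the difference of the values of \<open>u\<close> into a difference of truncated kernels. Where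
  both kernels are present, the mean value theorem yields the factor \<open>norm h\<close>; elsewhere, the point \<open>z\<close> lies
  in an annulus about the sphere of radius \<open>R\<close>, whose measure is of order \<open>norm h * R powr (N - 1)\<close>
  and on which \<open>u\<close> is bounded (\<open>kernel_increment_le\<close>, \<open>content_annulus_le\<close>).
  
  Distances from \<open>x\<close> are comparable to distances from \<open>xo\<close>, at the cost of powers of \<open>R / (R - r)\<close>
  (\<open>dist_exterior_ge\<close>). Hence everything reduces to the integral of one function,
  \<open>(T + \<bar>u z\<bar>) powr (p - 1) / norm (z - xo) powr (N + s * p)\<close> outside the ball of radius \<open>R / 2\<close>.
  Its integral is at most \<open>C / s * T powr (p - 1) / R powr (s * p)\<close> as soon as \<open>T\<close> bounds \<open>u\<close> on the ball of radius
  \<open>R + d\<close> and also bounds the tail outside of it (\<open>majorant_integral_le_scale\<close>). The factor \<open>1 / s\<close> arises from the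
  integral of the kernel alone, estimated on dyadic shells (\<open>nn_integral_kernel_le\<close>).
\<close>

section \<open>Scalar inequalities for powers\<close>

lemma powr_diff_le:
  fixes a b q :: real
  assumes "0 \<le> b" "b \<le> a" "1 \<le> q"
  shows "a powr q - b powr q \<le> q * a powr (q - 1) * (a - b)"
proof (cases "b = 0 \<or> a = b")
  case True
  have "a powr q = a powr (q - 1) * a"
    using assms by (cases "a = 0") (auto simp: powr_diff)
  then have "a powr q \<le> q * (a powr (q - 1) * a)"
    using assms mult_right_mono[of 1 q "a powr (q - 1) * a"] by simp
  with True show ?thesis
    by (auto simp: algebra_simps)
next
  case False
  then have b: "0 < b" "b < a"
    using assms by auto
  obtain z where z: "b < z" "z < a"
    and eq: "a powr q - b powr q = (a - b) * (q * z powr (q - 1))"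
  proof -
    have "\<exists>z>b. z < a \<and> a powr q - b powr q = (a - b) * (q * z powr (q - 1))"
      using b by (intro MVT2) (auto intro!: derivative_eq_intros)
    then show ?thesis
      using that by blast
  qed
  have "z powr (q - 1) \<le> a powr (q - 1)"
    using z b assms by (intro powr_mono2) auto
  then have "q * z powr (q - 1) * (a - b) \<le> q * a powr (q - 1) * (a - b)"
    using assms by (intro mult_mono) auto
  then show ?thesis
    unfolding eq by (simp add: algebra_simps)
qed

lemma V_minus: "V q (- a) = - V q a"
  by (simp add: V_def)

lemma abs_V: "\<bar>V q a\<bar> = \<bar>a\<bar> powr q"
  by (cases "a = 0") (auto simp: V_def abs_mult powr_diff)

lemma V_nonneg_eq: "0 \<le> a \<Longrightarrow> V q a = a powr q"
  using abs_V[of q a] by (simp add: V_def)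

text \<open>
  The derivative of \<open>V q\<close> is \<open>q \<bar>t\<bar> powr (q - 1)\<close>, which is at most \<open>q * m powr (q - 1)\<close> on \<open>[-m, m]\<close>.
  Since \<open>V q\<close> is odd, the inequality on \<open>[0, m]\<close> implies the one for arguments of arbitrary signs.
\<close>

lemma V_diff_le:
  assumes q: "1 \<le> q" and "\<bar>a\<bar> \<le> m" "\<bar>b\<bar> \<le> m"
  shows "\<bar>V q a - V q b\<bar> \<le> q * m powr (q - 1) * \<bar>a - b\<bar>"
proof -
  have same: "V q y - V q x \<le> q * m powr (q - 1) * (y - x)"
    if "0 \<le> x" "x \<le> y" "y \<le> m" for x y
  proof -
    have "V q y - V q x \<le> q * y powr (q - 1) * (y - x)"
      using powr_diff_le[of x y q] that q by (simp add: V_nonneg_eq)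
    also have "\<dots> \<le> q * m powr (q - 1) * (y - x)"
      using that q by (intro mult_mono powr_mono2) auto
    finally show ?thesis .
  qed
  have le: "V q y - V q x \<le> q * m powr (q - 1) * (y - x)"
    if xy: "x \<le> y" "\<bar>x\<bar> \<le> m" "\<bar>y\<bar> \<le> m" for x y
  proof -
    consider "0 \<le> x" | "y \<le> 0" | "x \<le> 0" "0 \<le> y"
      by linarith
    then show ?thesis
    proof cases
      case 1
      then show ?thesis using same[of x y] xy by auto
    next
      case 2
      then show ?thesis using same[of "-y" "-x"] xy by (auto simp: V_minus algebra_simps)
    next
      case 3
      then show ?thesis
        using same[of 0 y] same[of 0 "-x"] xy
        by (auto simp: V_minus V_nonneg_eq algebra_simps)
    qed
  qed
  have mono: "V q x \<le> V q y" if "x \<le> y" for x y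
  proof -
    consider "0 \<le> x" | "y \<le> 0" | "x \<le> 0" "0 \<le> y"
      by linarith
    then show ?thesis
    proof cases
      case 1
      then show ?thesis using that q by (auto simp: V_nonneg_eq intro!: powr_mono2)
    next
      case 2
      then have "V q (- y) \<le> V q (- x)"
        using that q by (simp add: V_nonneg_eq powr_mono2)
      then show ?thesis by (simp add: V_minus)
    next
      case 3
      then have "0 \<le> V q (- x)" "0 \<le> V q y"
        by (simp_all add: V_nonneg_eq)
      then show ?thesis by (simp add: V_minus)
    qed
  qed
  show ?thesis
    using le[of a b] le[of b a] mono[of a b] mono[of b a] assms by (cases "a \<le> b") auto
qed

lemma inverse_powr_diff_le:
  fixes X Y \<delta> \<alpha> :: real
  assumes "0 < \<delta>" "\<delta> \<le> X" "\<delta> \<le> Y" "0 \<le> \<alpha>"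
  shows "\<bar>1 / X powr \<alpha> - 1 / Y powr \<alpha>\<bar> \<le> \<alpha> / \<delta> powr (\<alpha> + 1) * \<bar>X - Y\<bar>"
proof -
  have bound: "norm (- \<alpha> * z powr (- \<alpha> - 1)) \<le> \<alpha> / \<delta> powr (\<alpha> + 1)" if "z \<in> {\<delta>..}" for z
  proof -
    have "z powr (- \<alpha> - 1) \<le> \<delta> powr (- \<alpha> - 1)"
      using that assms by (intro powr_mono2') auto
    also have "\<delta> powr (- \<alpha> - 1) = 1 / \<delta> powr (\<alpha> + 1)"
      using powr_minus_divide[of \<delta> "\<alpha> + 1"] by simp
    finally show ?thesis
      using assms mult_left_mono[of "z powr (- \<alpha> - 1)" "1 / \<delta> powr (\<alpha> + 1)" \<alpha>]
      by (simp add: abs_mult)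
  qed
  have "norm (X powr (- \<alpha>) - Y powr (- \<alpha>)) \<le> \<alpha> / \<delta> powr (\<alpha> + 1) * norm (X - Y)"
  proof (rule field_differentiable_bound[where S = "{\<delta>..}" and f' = "\<lambda>z. - \<alpha> * z powr (- \<alpha> - 1)"])
    show "((\<lambda>z. z powr - \<alpha>) has_field_derivative - \<alpha> * z powr (- \<alpha> - 1)) (at z within {\<delta>..})"
      if "z \<in> {\<delta>..}" for z
      using that assms by (auto intro!: derivative_eq_intros)
  qed (use assms bound in auto)
  then show ?thesis
    by (simp add: powr_minus_divide)
qed

text \<open>
  This is the source of the factor \<open>1 / s\<close> in the final constant: the geometric series with ratio
  \<open>2 powr (- t)\<close> sums to at most \<open>2 / s\<close>. It is convexity of the exponential on \<open>[-ln 2, 0]\<close>.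
\<close>

lemma one_minus_two_powr_ge:
  fixes s t :: real
  assumes "0 < s" "s < 1" "s \<le> t"
  shows "s / 2 \<le> 1 - 2 powr (- t)"
proof -
  have "2 powr (- t) \<le> 2 powr (- s)"
    using assms by (intro powr_mono) auto
  also have "\<dots> = exp ((1 - s) *\<^sub>R 0 + s *\<^sub>R (- ln 2))"
    by (simp add: powr_def)
  also have "\<dots> \<le> (1 - s) * exp 0 + s * exp (- ln 2)"
    using assms by (intro convex_onD[OF exp_convex]) auto
  also have "\<dots> = 1 - s / 2"
    by (simp add: exp_minus field_simps)
  finally show ?thesis by simp
qed

section \<open>Translation invariance of the complete Lebesgue measure\<close>

lemma distr_lebesgue_plus:
  fixes h :: "'a::euclidean_space"
  shows "distr lebesgue lebesgue (\<lambda>x. x + h) = lebesgue"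
    and lebesgue_measurable_plus: "(\<lambda>x. x + h) \<in> lebesgue \<rightarrow>\<^sub>M lebesgue"
proof -
  have eq: "(\<lambda>x. h + (\<Sum>j\<in>Basis. (1 * (x \<bullet> j)) *\<^sub>R j)) = (\<lambda>x. x + h)"
    by (simp add: euclidean_representation add.commute)
  show "(\<lambda>x. x + h) \<in> lebesgue \<rightarrow>\<^sub>M lebesgue"
    using lebesgue_affine_measurable[of "\<lambda>_. 1" h] eq by simp
  have "lebesgue = density (distr lebesgue lebesgue (\<lambda>x. x + h)) (\<lambda>_. 1)"
    using lebesgue_affine_euclidean[of "\<lambda>_. 1" h] eq by simp
  then show "distr lebesgue lebesgue (\<lambda>x. x + h) = lebesgue"
    by (simp add: density_1)
qed

lemma integral_shift:
  fixes f :: "'a::euclidean_space \<Rightarrow> real"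
  assumes "f \<in> borel_measurable lebesgue"
  shows "integrable lebesgue (\<lambda>x. f (x + h)) \<longleftrightarrow> integrable lebesgue f"
    and "(LINT x|lebesgue. f (x + h)) = (LINT x|lebesgue. f x)"
  using integrable_distr_eq[OF lebesgue_measurable_plus[of h] assms]
    integral_distr[OF lebesgue_measurable_plus[of h] assms]
    distr_lebesgue_plus[of h] by simp_all

lemma measurable_shift:
  fixes f :: "'a::euclidean_space \<Rightarrow> real"
  assumes "f \<in> borel_measurable lebesgue"
  shows "(\<lambda>x. f (x + h)) \<in> borel_measurable lebesgue"
  using measurable_compose[OF lebesgue_measurable_plus assms] .

lemma AE_shift:
  fixes h :: "'a::euclidean_space"
  assumes "AE x in lebesgue. P x"
  shows "AE x in lebesgue. P (x + h)"
proof (rule AE_distrD[OF lebesgue_measurable_plus])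
  show "AE x in distr lebesgue lebesgue (\<lambda>x. x + h). P x"
    by (subst distr_lebesgue_plus) (rule assms)
qed

section \<open>The kernel outside a ball, and thin annuli\<close>

lemma dyadic_scale:
  fixes v :: real
  assumes "1 \<le> v"
  obtains k :: nat where "2 ^ k \<le> v" "v < 2 ^ Suc k"
proof -
  obtain m :: nat where m: "v < 2 ^ m"
    using real_arch_pow[of 2 v] by auto
  define n where "n = (LEAST m. v < 2 ^ m)"
  have n: "v < 2 ^ n"
    unfolding n_def using m by (rule LeastI)
  then obtain k where k: "n = Suc k"
    using assms by (cases n) auto
  have "\<not> v < 2 ^ k"
    using not_less_Least[of k "\<lambda>m. v < 2 ^ m"] k unfolding n_def by simp
  with n k show ?thesis
    by (intro that[of k]) auto
qed

text \<open>
  On the dyadic shell \<open>2 ^ k \<rho> \<le> norm (z - xo) < 2 ^ (k + 1) \<rho>\<close> the kernel is at most its value at the inner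
  radius, and the volume of the shell is at most that of its outer ball. The resulting bounds form a geometric
  series with ratio \<open>2 powr (- t)\<close>. Apart from the scaling factor \<open>\<rho> powr (- t)\<close>, only the sum of that series
  depends on \<open>t\<close>.
\<close>

lemma nn_integral_kernel_le:
  fixes xo :: "'a::euclidean_space"
  assumes \<rho>: "0 < \<rho>" and t: "0 < t"
  shows "(\<integral>\<^sup>+ z. ennreal (indicator (- ball xo \<rho>) z * (1 / norm (z - xo) powr (real DIM('a) + t))) \<partial>lebesgue)
    \<le> ennreal (2 ^ DIM('a) * unit_ball_vol (DIM('a)) * \<rho> powr (- t) / (1 - 2 powr (- t)))"
proof -
  define N where "N = DIM('a)"
  define \<omega> where "\<omega> = unit_ball_vol (DIM('a))"
  have [measurable]: "ball xo c \<in> sets lebesgue" for c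
    by simp
  define a where "a k = 1 / (2 ^ k * \<rho>) powr (N + t)" for k :: nat
  define r where "r k = 2 ^ Suc k * \<rho>" for k :: nat
  have q: "0 < 2 powr (- t)" "2 powr (- t) < 1"
    using t by (auto simp: powr_less_one)
  have "indicator (- ball xo \<rho>) z * (1 / norm (z - xo) powr (N + t))
      \<le> (\<Sum>k. ennreal (a k) * indicator (ball xo (r k)) z)" for z
  proof (cases "z \<in> ball xo \<rho>")
    case False
    then have "1 \<le> norm (z - xo) / \<rho>"
      using \<rho> by (simp add: dist_norm norm_minus_commute)
    then obtain k where k: "2 ^ k \<le> norm (z - xo) / \<rho>" "norm (z - xo) / \<rho> < 2 ^ Suc k"
      by (rule dyadic_scale)
    have le: "2 ^ k * \<rho> \<le> norm (z - xo)" and mem: "z \<in> ball xo (r k)"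
      using k \<rho> by (auto simp: field_simps r_def dist_norm norm_minus_commute)
    have "(2 ^ k * \<rho>) powr (N + t) \<le> norm (z - xo) powr (N + t)"
      using le \<rho> t by (intro powr_mono2) auto
    then have "1 / norm (z - xo) powr (N + t) \<le> a k"
      unfolding a_def using \<rho> by (intro divide_left_mono mult_pos_pos) (auto intro!: powr_gt_zero[THEN iffD2] less_le_trans[OF _ le])
    then have "ennreal (1 / norm (z - xo) powr (N + t)) \<le> ennreal (a k) * indicator (ball xo (r k)) z"
      using mem by (simp add: ennreal_leI)
    also have "\<dots> \<le> (\<Sum>k. ennreal (a k) * indicator (ball xo (r k)) z)"
      using sum_le_suminf[of "\<lambda>k. ennreal (a k) * indicator (ball xo (r k)) z" "{k}"]
      by (simp del: sum_mult_indicator)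
    finally show ?thesis
      using False by simp
  qed simp
  then have "(\<integral>\<^sup>+ z. ennreal (indicator (- ball xo \<rho>) z * (1 / norm (z - xo) powr (N + t))) \<partial>lebesgue)
      \<le> (\<integral>\<^sup>+ z. (\<Sum>k. ennreal (a k) * indicator (ball xo (r k)) z) \<partial>lebesgue)"
    by (intro nn_integral_mono) simp
  also have "\<dots> = (\<Sum>k. ennreal (a k) * emeasure lebesgue (ball xo (r k)))"
    by (subst nn_integral_suminf) (simp_all add: nn_integral_cmult_indicator)
  also have "\<dots> = (\<Sum>k. ennreal (2 ^ N * \<omega> * \<rho> powr (- t) * (2 powr (- t)) ^ k))"
  proof (intro suminf_cong)
    fix k
    have "emeasure lebesgue (ball xo (r k)) = ennreal (r k ^ N * \<omega>)"
      using \<rho> by (simp add: emeasure_ball r_def N_def \<omega>_def mult.commute)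
    moreover have "a k * (r k ^ N * \<omega>) = 2 ^ N * \<omega> * \<rho> powr (- t) * (2 powr (- t)) ^ k"
    proof -
      define D where "D = (2 ^ k * \<rho>) ^ N"
      have "(2 ^ k * \<rho>) powr (N + t) = D * ((2 ^ k) powr t * \<rho> powr t)"
        using \<rho> by (simp only: D_def powr_add powr_realpow mult_pos_pos zero_less_power zero_less_numeral
            flip: powr_mult)
      moreover have "((2::real) ^ k) powr t = (2 powr t) ^ k"
        by (simp add: powr_realpow[symmetric] powr_powr mult.commute)
      moreover have "r k ^ N = 2 ^ N * D"
        by (simp only: D_def r_def power_Suc mult.assoc flip: power_mult_distrib)
      moreover have "0 < D"
        using \<rho> by (simp add: D_def)
      ultimately have "a k * (r k ^ N * \<omega>) = 2 ^ N * \<omega> * (1 / \<rho> powr t) * (1 / (2 powr t) ^ k)"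
        using \<rho> by (simp add: a_def divide_simps)
      then show ?thesis
        by (simp add: powr_minus_divide power_one_over)
    qed
    ultimately show "ennreal (a k) * emeasure lebesgue (ball xo (r k))
        = ennreal (2 ^ N * \<omega> * \<rho> powr (- t) * (2 powr (- t)) ^ k)"
      using \<rho> by (simp add: ennreal_mult'[symmetric] a_def)
  qed
  also have "\<dots> = ennreal (\<Sum>k. 2 ^ N * \<omega> * \<rho> powr (- t) * (2 powr (- t)) ^ k)"
    using q by (intro suminf_ennreal2 summable_mult summable_geometric) (auto simp: \<omega>_def)
  also have "(\<Sum>k. 2 ^ N * \<omega> * \<rho> powr (- t) * (2 powr (- t)) ^ k)
      = 2 ^ N * \<omega> * \<rho> powr (- t) / (1 - 2 powr (- t))"
    using q by (subst suminf_mult) (auto simp: suminf_geometric intro!: summable_geometric)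
  finally show ?thesis
    by (simp add: N_def \<omega>_def)
qed

lemma content_annulus_le:
  fixes xo :: "'a::euclidean_space"
  assumes "0 \<le> \<eta>" "\<eta> < R"
  shows "measure lebesgue (ball xo (R + \<eta>) - ball xo (R - \<eta>))
    \<le> unit_ball_vol (DIM('a)) * (DIM('a) * (2 * R) powr (DIM('a) - 1) * (2 * \<eta>))"
proof -
  let ?N = "real DIM('a)"
  have "measure lebesgue (ball xo (R + \<eta>) - ball xo (R - \<eta>))
      = measure lebesgue (ball xo (R + \<eta>)) - measure lebesgue (ball xo (R - \<eta>))"
    using assms by (intro measurable_measure_Diff) auto
  also have "\<dots> = unit_ball_vol (DIM('a)) * ((R + \<eta>) powr ?N - (R - \<eta>) powr ?N)"
    using assms by (simp add: content_ball powr_realpow algebra_simps)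
  also have "(R + \<eta>) powr ?N - (R - \<eta>) powr ?N \<le> ?N * (R + \<eta>) powr (?N - 1) * ((R + \<eta>) - (R - \<eta>))"
    using assms by (intro powr_diff_le) (auto simp: Suc_le_eq)
  also have "\<dots> \<le> ?N * (2 * R) powr (?N - 1) * (2 * \<eta>)"
    using assms by (intro mult_mono powr_mono2) (auto simp: Suc_le_eq)
  finally show ?thesis
    by (simp add: mult_left_mono of_nat_diff)
qed

section \<open>Integrability outside a ball and the majorant\<close>

lemma powr_add_le:
  fixes a b q :: real
  assumes "0 \<le> a" "0 \<le> b" "0 \<le> q"
  shows "(a + b) powr q \<le> 2 powr q * (a powr q + b powr q)"
proof -
  have "(a + b) powr q \<le> (2 * max a b) powr q"
    using assms by (intro powr_mono2) auto
  also have "\<dots> = 2 powr q * max a b powr q"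
    using assms by (simp add: powr_mult)
  also have "max a b powr q \<le> a powr q + b powr q"
    by (simp add: max_def)
  finally show ?thesis
    by simp
qed

lemma measurable_kernel:
  fixes xo :: "'a::euclidean_space"
  shows "(\<lambda>z. norm (z - xo) powr \<alpha>) \<in> borel_measurable lebesgue"
    and "indicator (- ball xo \<rho>) \<in> borel_measurable lebesgue"
proof -
  have "(\<lambda>z. norm (z - xo) powr \<alpha>) \<in> borel_measurable borel"
    by measurable
  then show "(\<lambda>z. norm (z - xo) powr \<alpha>) \<in> borel_measurable lebesgue"
    by (intro measurable_completion) simp
  have [measurable]: "ball xo \<rho> \<in> sets lebesgue"
    by simp
  show "indicator (- ball xo \<rho>) \<in> borel_measurable lebesgue"
    by measurable
qed

lemma kernel_integrable:
  fixes xo :: "'a::euclidean_space"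
  assumes "0 < \<rho>" "0 < t"
  shows "integrable lebesgue (\<lambda>z. indicator (- ball xo \<rho>) z * (1 / norm (z - xo) powr (real DIM('a) + t)))"
    and "(LINT z|lebesgue. indicator (- ball xo \<rho>) z * (1 / norm (z - xo) powr (real DIM('a) + t)))
      \<le> 2 ^ DIM('a) * unit_ball_vol (DIM('a)) * \<rho> powr (- t) / (1 - 2 powr (- t))"
proof -
  let ?k = "\<lambda>z. indicator (- ball xo \<rho>) z * (1 / norm (z - xo) powr (real DIM('a) + t))"
  note [measurable] = measurable_kernel
  show "integrable lebesgue ?k"
  proof (rule integrableI_bounded)
    have "(\<integral>\<^sup>+ z. ennreal (norm (?k z)) \<partial>lebesgue) = (\<integral>\<^sup>+ z. ennreal (?k z) \<partial>lebesgue)"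
      by (intro nn_integral_cong) (auto simp: indicator_def)
    also have "\<dots> < \<infinity>"
      using nn_integral_kernel_le[OF assms, of xo] by (simp add: le_less_trans)
    finally show "(\<integral>\<^sup>+ z. ennreal (norm (?k z)) \<partial>lebesgue) < \<infinity>" .
  qed measurable
  have "2 powr (- t) \<le> 1"
    using assms by (auto intro!: less_imp_le powr_less_one)
  then show "(LINT z|lebesgue. ?k z)
      \<le> 2 ^ DIM('a) * unit_ball_vol (DIM('a)) * \<rho> powr (- t) / (1 - 2 powr (- t))"
    by (intro integral_real_bounded nn_integral_kernel_le[OF assms]) simp
qed

lemma L_sp_measurable:
  assumes "u \<in> L_sp s p"
  shows "u \<in> borel_measurable lebesgue"
  using assms by (simp add: L_sp_def L_loc_def)

text \<open>
  Outside a ball of positive radius about \<open>xo\<close>, the weight \<open>1 + norm z\<close> is at most a constant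
  multiple of \<open>norm (z - xo)\<close>.
\<close>

lemma L_sp_integrable_exterior:
  fixes u :: "real ^ 'n \<Rightarrow> real"
  assumes u: "u \<in> L_sp s p" and "0 < \<rho>" "0 < s" "2 \<le> p"
  shows "integrable lebesgue
    (\<lambda>z. indicator (- ball xo \<rho>) z * (\<bar>u z\<bar> powr (p - 1) / norm (z - xo) powr (real CARD('n) + s * p)))"
    (is "integrable _ ?f")
proof -
  let ?\<alpha> = "real CARD('n) + s * p"
  let ?g = "\<lambda>z. \<bar>u z\<bar> powr (p - 1) / (1 + norm z) powr ?\<alpha>"
  define c where "c = (1 + norm xo) / \<rho> + 1"
  note [measurable] = L_sp_measurable[OF u] measurable_kernel
  have \<alpha>: "0 < ?\<alpha>"
    using assms by (simp add: add_pos_nonneg)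
  have c: "0 < c"
    using assms by (auto simp: c_def intro!: add_nonneg_pos)
  have [measurable]: "(\<lambda>z::real^'n. (1 + norm z) powr ?\<alpha>) \<in> borel_measurable lebesgue"
  proof -
    have "(\<lambda>z::real^'n. (1 + norm z) powr ?\<alpha>) \<in> borel_measurable borel"
      by measurable
    then show ?thesis
      by (intro measurable_completion) simp
  qed
  have "integrable lebesgue ?g"
    using u by (intro integrableI_bounded) (auto simp: L_sp_def)
  then have "integrable lebesgue (\<lambda>z. c powr ?\<alpha> * ?g z)"
    by (rule integrable_mult_right)
  then show ?thesis
  proof (rule Bochner_Integration.integrable_bound)
    show "AE z in lebesgue. norm (?f z) \<le> norm (c powr ?\<alpha> * ?g z)"
    proof (rule AE_I2)
      fix z
      show "norm (?f z) \<le> norm (c powr ?\<alpha> * ?g z)"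
      proof (cases "z \<in> ball xo \<rho>")
        case False
        then have \<rho>: "\<rho> \<le> norm (z - xo)"
          by (simp add: dist_norm norm_minus_commute)
        then have pos: "0 < norm (z - xo)"
          using assms by linarith
        have "1 + norm z \<le> (1 + norm xo) * 1 + norm (z - xo)"
          using norm_triangle_ineq[of "z - xo" xo] by simp
        also have "\<dots> \<le> (1 + norm xo) * (norm (z - xo) / \<rho>) + norm (z - xo)"
          using \<rho> assms by (intro add_mono mult_left_mono) (auto simp: add_nonneg_nonneg)
        also have "\<dots> = c * norm (z - xo)"
          by (simp add: c_def field_simps)
        finally have "(1 + norm z) powr ?\<alpha> \<le> (c * norm (z - xo)) powr ?\<alpha>"
          using \<alpha> by (intro powr_mono2) auto
        then have "(1 + norm z) powr ?\<alpha> \<le> c powr ?\<alpha> * norm (z - xo) powr ?\<alpha>"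
          using c by (simp add: powr_mult)
        moreover have "0 < (1 + norm z) powr ?\<alpha>" "0 < norm (z - xo) powr ?\<alpha>"
          using pos by (auto simp: add_pos_nonneg less_imp_neq[symmetric])
        ultimately have "1 / norm (z - xo) powr ?\<alpha> \<le> c powr ?\<alpha> * (1 / (1 + norm z) powr ?\<alpha>)"
          by (simp add: field_simps)
        then have "\<bar>u z\<bar> powr (p - 1) * (1 / norm (z - xo) powr ?\<alpha>)
            \<le> \<bar>u z\<bar> powr (p - 1) * (c powr ?\<alpha> * (1 / (1 + norm z) powr ?\<alpha>))"
          by (rule mult_left_mono) simp
        with False show ?thesis
          by (simp add: abs_mult mult_ac)
      qed simp
    qed
  qed measurable
qed

text \<open>
  A single integrable function that dominates, up to constants, every integrand of the proof. Adding \<open>T\<close>, a bound for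
  \<open>u x\<close> and \<open>u (x + h)\<close>, to \<open>\<bar>u z\<bar>\<close> makes \<open>(T + \<bar>u z\<bar>) powr (p - 1)\<close> a bound for
  \<open>\<bar>V (p - 1) (u x - u z)\<bar>\<close>. As the base is at least \<open>T\<close>, the lower power with exponent \<open>p - 2\<close> is at most
  \<open>1 / T\<close> times this one, so that no interpolation between the two powers is necessary.
\<close>

definition majorant :: "real \<Rightarrow> real \<Rightarrow> real \<Rightarrow> (real ^ 'n \<Rightarrow> real) \<Rightarrow> real ^ 'n \<Rightarrow> real \<Rightarrow> real ^ 'n \<Rightarrow> real"
  where "majorant s p T u xo \<rho> z =
    indicator (- ball xo \<rho>) z * ((T + \<bar>u z\<bar>) powr (p - 1) / norm (z - xo) powr (real CARD('n) + s * p))"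

lemma majorant_nonneg: "0 \<le> majorant s p T u xo \<rho> z"
  by (simp add: majorant_def)

lemma majorant_measurable [measurable]:
  assumes [measurable]: "u \<in> borel_measurable lebesgue"
  shows "majorant s p T u xo \<rho> \<in> borel_measurable lebesgue"
proof -
  note [measurable] = measurable_kernel
  show ?thesis
    unfolding majorant_def by measurable
qed

lemma majorant_integrable:
  fixes u :: "real ^ 'n \<Rightarrow> real"
  assumes u: "u \<in> L_sp s p" and "0 < \<rho>" "0 < s" "2 \<le> p" "0 \<le> T"
  shows "integrable lebesgue (majorant s p T u xo \<rho>)"
proof -
  let ?\<alpha> = "real CARD('n) + s * p"
  let ?k = "\<lambda>z. indicator (- ball xo \<rho>) z * (1 / norm (z - xo) powr ?\<alpha>)"
  let ?f = "\<lambda>z. indicator (- ball xo \<rho>) z * (\<bar>u z\<bar> powr (p - 1) / norm (z - xo) powr ?\<alpha>)"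
  note [measurable] = L_sp_measurable[OF u]
  have "integrable lebesgue ?k"
    using kernel_integrable(1)[of \<rho> "s * p" xo] assms by simp
  then have "integrable lebesgue (\<lambda>z. 2 powr (p - 1) * T powr (p - 1) * ?k z + 2 powr (p - 1) * ?f z)"
    using L_sp_integrable_exterior[OF u, of \<rho> xo] assms
    by (intro Bochner_Integration.integrable_add integrable_mult_right) auto
  then show ?thesis
  proof (rule Bochner_Integration.integrable_bound)
    show "AE z in lebesgue. norm (majorant s p T u xo \<rho> z)
      \<le> norm (2 powr (p - 1) * T powr (p - 1) * ?k z + 2 powr (p - 1) * ?f z)"
    proof (rule AE_I2)
      fix z
      have "majorant s p T u xo \<rho> z = ?k z * (T + \<bar>u z\<bar>) powr (p - 1)"
        by (simp add: majorant_def)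
      also have "\<dots> \<le> ?k z * (2 powr (p - 1) * (T powr (p - 1) + \<bar>u z\<bar> powr (p - 1)))"
        using assms by (intro mult_left_mono powr_add_le) auto
      also have "\<dots> = 2 powr (p - 1) * T powr (p - 1) * ?k z + 2 powr (p - 1) * ?f z"
        by (simp add: algebra_simps)
      also have "\<dots> \<le> norm (2 powr (p - 1) * T powr (p - 1) * ?k z + 2 powr (p - 1) * ?f z)"
        by (simp only: real_norm_def abs_ge_self)
      finally show "norm (majorant s p T u xo \<rho> z)
          \<le> norm (2 powr (p - 1) * T powr (p - 1) * ?k z + 2 powr (p - 1) * ?f z)"
        by (simp only: real_norm_def abs_of_nonneg majorant_nonneg)
    qed
  qed measurable
qed

text \<open>
  Inside the larger ball \<open>u\<close> is bounded by \<open>T\<close>, which leaves a multiple of the kernel; outside of it,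
  \<open>T + \<bar>u z\<bar>\<close> splits into a second multiple of the kernel and the integrand of the tail.
\<close>

lemma majorant_integral_le:
  fixes u :: "real ^ 'n \<Rightarrow> real"
  assumes u: "u \<in> L_sp s p" and "0 < s" "2 \<le> p" "0 \<le> T" "0 < \<rho>" "\<rho> \<le> \<rho>'"
    and bounded: "AE z in lebesgue. z \<in> ball xo \<rho>' \<longrightarrow> \<bar>u z\<bar> \<le> T"
  shows "(LINT z|lebesgue. majorant s p T u xo \<rho> z) \<le> 2 powr (p - 1) *
    (2 ^ CARD('n) * unit_ball_vol (CARD('n)) * \<rho> powr (- (s * p)) / (1 - 2 powr (- (s * p))) * T powr (p - 1)
     + (LINT z|lebesgue. indicator (- ball xo \<rho>') z * (\<bar>u z\<bar> powr (p - 1) / norm (z - xo) powr (real CARD('n) + s * p))))"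
proof -
  let ?\<alpha> = "real CARD('n) + s * p"
  let ?k = "\<lambda>z. indicator (- ball xo \<rho>) z * (1 / norm (z - xo) powr ?\<alpha>)"
  let ?f = "\<lambda>z. indicator (- ball xo \<rho>') z * (\<bar>u z\<bar> powr (p - 1) / norm (z - xo) powr ?\<alpha>)"
  note [measurable] = L_sp_measurable[OF u]
  have k: "integrable lebesgue ?k" "(LINT z|lebesgue. ?k z)
      \<le> 2 ^ CARD('n) * unit_ball_vol (CARD('n)) * \<rho> powr (- (s * p)) / (1 - 2 powr (- (s * p)))"
    using kernel_integrable[of \<rho> "s * p" xo] assms by simp_all
  have f: "integrable lebesgue ?f"
    using L_sp_integrable_exterior[OF u, of \<rho>' xo] assms by simp
  have "(LINT z|lebesgue. majorant s p T u xo \<rho> z)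
      \<le> (LINT z|lebesgue. 2 powr (p - 1) * (T powr (p - 1) * ?k z + ?f z))"
  proof (rule integral_mono_AE)
    show "AE z in lebesgue. majorant s p T u xo \<rho> z \<le> 2 powr (p - 1) * (T powr (p - 1) * ?k z + ?f z)"
      using bounded
    proof eventually_elim
      case (elim z)
      show ?case
      proof (cases "z \<in> ball xo \<rho>'")
        case True
        with elim have "(T + \<bar>u z\<bar>) powr (p - 1) \<le> (2 * T) powr (p - 1)"
          using assms by (intro powr_mono2) auto
        then have "?k z * (T + \<bar>u z\<bar>) powr (p - 1) \<le> ?k z * (2 powr (p - 1) * T powr (p - 1))"
          using assms by (intro mult_left_mono) (auto simp: powr_mult)
        with True show ?thesis
          by (simp add: majorant_def algebra_simps)
      next
        case False
        then have far: "z \<notin> ball xo \<rho>"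
          using assms by auto
        have "?k z * (T + \<bar>u z\<bar>) powr (p - 1)
            \<le> ?k z * (2 powr (p - 1) * (T powr (p - 1) + \<bar>u z\<bar> powr (p - 1)))"
          using assms by (intro mult_left_mono powr_add_le) auto
        with False far show ?thesis
          by (simp add: majorant_def algebra_simps)
      qed
    qed
  next
    show "integrable lebesgue (majorant s p T u xo \<rho>)"
      using assms by (intro majorant_integrable) auto
    show "integrable lebesgue (\<lambda>z. 2 powr (p - 1) * (T powr (p - 1) * ?k z + ?f z))"
      by (intro integrable_mult_right Bochner_Integration.integrable_add k(1) f)
  qed
  also have "\<dots> = 2 powr (p - 1) * (T powr (p - 1) * (LINT z|lebesgue. ?k z) + (LINT z|lebesgue. ?f z))"
    by (simp only: integral_mult_right_zero Bochner_Integration.integral_add[OF integrable_mult_right[OF k(1)] f])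
  also have "\<dots> \<le> 2 powr (p - 1) * (T powr (p - 1)
      * (2 ^ CARD('n) * unit_ball_vol (CARD('n)) * \<rho> powr (- (s * p)) / (1 - 2 powr (- (s * p))))
      + (LINT z|lebesgue. ?f z))"
    using k(2) by (intro mult_left_mono add_mono) auto
  finally show ?thesis
    by (simp only: mult.commute[of "T powr (p - 1)"])
qed


section \<open>Distances and kernel increments\<close>

text \<open>
  The point \<open>x\<close> stays at distance at least \<open>(R - r) / 2\<close> from the sphere of radius \<open>R\<close>, so that
  \<open>norm (x - y)\<close> is at least \<open>(R - r) / (2 * R)\<close> times \<open>norm (y - xo)\<close>. Another factor
  \<open>1 / 2\<close> accommodates the translation by \<open>h\<close>, because \<open>norm h \<le> R \<le> norm (y - xo)\<close>.
\<close>

lemma dist_exterior_ge: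
  fixes x y h xo :: "'a::euclidean_space"
  assumes "0 < r" "r < R" and x: "norm (x - xo) < (R + r) / 2" and h: "norm h \<le> (R - r) / 4"
    and y: "y \<notin> ball xo R"
  shows "(R - r) / (4 * R) * norm (y - xo) \<le> norm (x - y)"
    and "(R - r) / (4 * R) * norm (y + h - xo) \<le> norm (x - y)"
    and "R / 2 \<le> norm (y + h - xo)"
proof -
  define v where "v = norm (y - xo)"
  have v: "R \<le> v"
    using y by (simp add: v_def dist_norm norm_minus_commute)
  have "v \<le> norm (x - y) + norm (x - xo)"
    unfolding v_def using norm_triangle_ineq4[of "x - xo" "x - y"] by simp
  then have far: "v - (R + r) / 2 \<le> norm (x - y)"
    using x by linarith
  have "(R + r) * R \<le> (R + r) * v"
    using v assms by (intro mult_left_mono) auto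
  then have "(R - r) / (2 * R) * v \<le> v - (R + r) / 2"
    using assms by (simp add: field_simps)
  with far have main: "(R - r) / (2 * R) * v \<le> norm (x - y)"
    by linarith
  have shift: "norm (y + h - xo) \<le> v + norm h" "v - norm h \<le> norm (y + h - xo)"
    using norm_triangle_ineq[of "y - xo" h] norm_triangle_ineq4[of "y + h - xo" h]
    by (simp_all add: v_def algebra_simps)
  have "norm h \<le> v"
    using v h assms(1,2) by simp
  have "norm (y + h - xo) \<le> 2 * v"
    using shift(1) \<open>norm h \<le> v\<close> by linarith
  then have "(R - r) / (4 * R) * norm (y + h - xo) \<le> (R - r) / (4 * R) * (2 * v)"
    using assms by (intro mult_left_mono) auto
  also have "\<dots> = (R - r) / (2 * R) * v"
    by simp
  finally show "(R - r) / (4 * R) * norm (y + h - xo) \<le> norm (x - y)"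
    using main by linarith
  have "(R - r) / (4 * R) * v \<le> (R - r) / (2 * R) * v"
    using v assms by (intro mult_right_mono divide_left_mono) auto
  with main show "(R - r) / (4 * R) * norm (y - xo) \<le> norm (x - y)"
    unfolding v_def by linarith
  show "R / 2 \<le> norm (y + h - xo)"
    using shift(2) v h assms(1,2) by simp
qed

text \<open>
  This is the kernel left after the translation \<open>z = y + h\<close> in the integral of the shifted function. Where both
  truncations are active, the mean value theorem gives one more factor \<open>c * norm (z - xo)\<close> in the denominator,
  and \<open>norm (z - xo)\<close> is at least \<open>R / 2\<close>. Where just one is active, the kernel has no
  smallness in \<open>h\<close>; it is bounded by its maximum, and such points lie in an annulus of width \<open>2 * norm h\<close>.
\<close>

lemma kernel_increment_le:
  fixes x z h xo :: "'a::euclidean_space"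
  assumes r: "0 < r" "r < R" and x: "norm (x - xo) < (R + r) / 2" and h: "norm h \<le> (R - r) / 4"
    and \<alpha>: "0 \<le> \<alpha>" and c: "c = (R - r) / (4 * R)"
  shows "\<bar>indicator (- ball (xo + h) R) z * (1 / norm (x + h - z) powr \<alpha>)
      - indicator (- ball xo R) z * (1 / norm (x - z) powr \<alpha>)\<bar>
    \<le> 2 * \<alpha> * norm h / (R * c powr (\<alpha> + 1)) * (indicator (- ball xo (R / 2)) z * (1 / norm (z - xo) powr \<alpha>))
      + (2 / (c * R)) powr \<alpha> * indicator (ball xo (R + norm h) - ball xo (R - norm h)) z"
    (is "\<bar>?k\<bar> \<le> ?C1 * (?i * ?K) + ?C2 * ?j")
proof -
  have c0: "0 < c"
    using r c by simp
  have nonneg: "0 \<le> ?C1 * (?i * ?K)" "0 \<le> ?C2 * ?j"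
    using \<alpha> r c0 by (auto intro!: mult_nonneg_nonneg divide_nonneg_nonneg)
  have dz: "dist xo z = norm (z - xo)" "dist (xo + h) z = norm (z - h - xo)"
    by (simp_all add: dist_norm norm_minus_commute algebra_simps)
  have tri: "norm (z - h - xo) \<le> norm (z - xo) + norm h" "norm (z - xo) \<le> norm (z - h - xo) + norm h"
    using norm_triangle_ineq4[of "z - xo" h] norm_triangle_ineq[of "z - h - xo" h]
    by (simp_all add: algebra_simps)
  have shifted: "c * norm (z - xo) \<le> norm (x + h - z)" "R / 2 \<le> norm (z - xo)"
    if "z \<notin> ball (xo + h) R"
    using dist_exterior_ge[OF r x h, of "z - h"] that unfolding c
    by (simp_all add: dist_norm norm_minus_commute algebra_simps)
  have unshifted: "c * norm (z - xo) \<le> norm (x - z)"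
    if "z \<notin> ball xo R"
    using dist_exterior_ge(1)[OF r x h that] unfolding c .
  have far: "1 / D powr \<alpha> \<le> ?C2" if "c * norm (z - xo) \<le> D" "R / 2 \<le> norm (z - xo)" for D
  proof -
    have "c * (R / 2) \<le> c * norm (z - xo)"
      using c0 that by (intro mult_left_mono) auto
    then have "c * (R / 2) \<le> D"
      using that(1) by linarith
    have "0 < c * (R / 2)"
      using c0 r by simp
    with \<open>c * (R / 2) \<le> D\<close> have "0 < D"
      by linarith
    then have "(1 / D) powr \<alpha> \<le> (1 / (c * (R / 2))) powr \<alpha>"
      using \<alpha> c0 r \<open>c * (R / 2) \<le> D\<close> \<open>0 < D\<close>
      by (intro powr_mono2 divide_left_mono mult_pos_pos) auto
    then show ?thesis
      using c0 r \<open>0 < D\<close> by (simp add: powr_divide)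
  qed
  consider "z \<notin> ball (xo + h) R" "z \<notin> ball xo R" | "z \<notin> ball (xo + h) R" "z \<in> ball xo R"
    | "z \<in> ball (xo + h) R" "z \<notin> ball xo R" | "z \<in> ball (xo + h) R" "z \<in> ball xo R"
    by blast
  then show ?thesis
  proof cases
    case 1
    have R2: "R / 2 \<le> norm (z - xo)"
      using shifted(2) 1 by simp
    define \<delta> where "\<delta> = c * norm (z - xo)"
    have \<delta>: "0 < \<delta>"
      using c0 R2 r unfolding \<delta>_def by (intro mult_pos_pos) linarith+
    have "\<bar>?k\<bar> \<le> \<alpha> / \<delta> powr (\<alpha> + 1) * \<bar>norm (x + h - z) - norm (x - z)\<bar>"
      using inverse_powr_diff_le[OF \<delta> _ _ \<alpha>, of "norm (x + h - z)" "norm (x - z)"]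
        shifted(1) unshifted 1 unfolding \<delta>_def by simp
    also have "\<dots> \<le> \<alpha> / \<delta> powr (\<alpha> + 1) * norm h"
      using norm_triangle_ineq3[of "x + h - z" "x - z"] \<alpha> by (intro mult_left_mono) auto
    also have "\<dots> \<le> \<alpha> * (2 / R * (1 / (c powr (\<alpha> + 1) * norm (z - xo) powr \<alpha>))) * norm h"
    proof -
      have "c powr (\<alpha> + 1) * norm (z - xo) powr \<alpha> * (R / 2)
          \<le> c powr (\<alpha> + 1) * norm (z - xo) powr \<alpha> * norm (z - xo)"
        using R2 by (intro mult_left_mono) auto
      also have "\<dots> = \<delta> powr (\<alpha> + 1)"
        using R2 r c0 by (simp add: \<delta>_def powr_mult powr_add mult_ac)
      finally have "1 / \<delta> powr (\<alpha> + 1) \<le> 1 / (c powr (\<alpha> + 1) * norm (z - xo) powr \<alpha> * (R / 2))"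
        using c0 R2 r \<delta> by (intro divide_left_mono mult_pos_pos) auto
      then have "\<alpha> * (1 / \<delta> powr (\<alpha> + 1)) * norm h
          \<le> \<alpha> * (1 / (c powr (\<alpha> + 1) * norm (z - xo) powr \<alpha> * (R / 2))) * norm h"
        using \<alpha> by (intro mult_right_mono mult_left_mono) auto
      then show ?thesis
        by (simp add: mult_ac)
    qed
    also have "\<dots> = ?C1 * (?i * ?K)"
      using R2 by (simp add: dz mult_ac)
    finally show ?thesis
      using nonneg(2) by linarith
  next
    case 2
    then have "?j = 1"
      using tri by (auto simp: dz)
    with 2 nonneg(1) far[OF shifted] show ?thesis
      by simp
  next
    case 3
    then have "?j = 1"
      using tri by (auto simp: dz)
    moreover have "R / 2 \<le> norm (z - xo)"
      using 3 r by (simp add: dz)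
    ultimately show ?thesis
      using 3 nonneg(1) far[OF unshifted] by simp
  next
    case 4
    with nonneg show ?thesis by simp
  qed
qed

section \<open>The increment of the nonlocal integral\<close>

lemma V_measurable [measurable]: "V q \<in> borel_measurable borel"
  unfolding V_def by measurable

text \<open>
  The integrand is \<open>F1 + F2 (\<cdot> + h) - F3\<close>. In \<open>F1\<close> only the value of \<open>u\<close> at the
  fixed point changes, from \<open>u x\<close> to \<open>u (x + h)\<close>; in \<open>F2 (\<cdot> + h) - F3\<close> only the value at the integration
  variable changes. Translating \<open>F2\<close> by \<open>h\<close> moves this second change from \<open>u\<close>, which is merely measurable,
  to the kernel, which is smooth away from its pole.
\<close>

lemma nonlocal_increment_estimate:
  fixes u :: "real ^ 'n \<Rightarrow> real"
  assumes u: "u \<in> L_sp s p" and s: "0 < s" and p: "2 \<le> p"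
    and r: "0 < r" "r < R" and x: "norm (x - xo) < (R + r) / 2" and h: "norm h \<le> (R - r) / 4"
    and T: "0 < T" "\<bar>u x\<bar> \<le> T" "\<bar>u (x + h)\<bar> \<le> T"
    and c: "c = (R - r) / (4 * R)" and \<alpha>: "\<alpha> = real CARD('n) + s * p"
    and J: "J = (LINT z|lebesgue. majorant s p T u xo (R / 2) z)"
  shows "set_integrable lebesgue (- ball xo R) (nonlocal_integrand s p u h x)"
    and "(AE z in lebesgue. z \<in> ball xo (R + norm h) \<longrightarrow> \<bar>u z\<bar> \<le> T) \<Longrightarrow>
      \<bar>LINT y : - ball xo R | lebesgue. nonlocal_integrand s p u h x y\<bar>
      \<le> (p - 1) * \<bar>tau h u x\<bar> / (T * c powr \<alpha>) * J
        + 2 * \<alpha> * norm h / (R * c powr (\<alpha> + 1)) * J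
        + (2 * T) powr (p - 1) * (2 / (c * R)) powr \<alpha>
          * measure lebesgue (ball xo (R + norm h) - ball xo (R - norm h))"
proof -
  define a a' where "a = u x" and "a' = u (x + h)"
  define K where "K = majorant s p T u xo (R / 2)"
  define F1 where "F1 y = indicator (- ball xo R) y
    * ((V (p - 1) (a' - u (y + h)) - V (p - 1) (a - u (y + h))) / norm (x - y) powr \<alpha>)" for y
  define F2 where "F2 z = indicator (- ball (xo + h) R) z
    * (V (p - 1) (a - u z) / norm (x + h - z) powr \<alpha>)" for z
  define F3 where "F3 z = indicator (- ball xo R) z * (V (p - 1) (a - u z) / norm (x - z) powr \<alpha>)" for z
  have \<alpha>0: "0 < \<alpha>"
    using s p by (simp add: \<alpha> add_pos_nonneg)
  have c0: "0 < c"
    using r c by simp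
  note [measurable] = L_sp_measurable[OF u] measurable_kernel
  have [measurable]: "(\<lambda>y. u (y + h)) \<in> borel_measurable lebesgue"
    using L_sp_measurable[OF u] by (rule measurable_shift)
  have [measurable]: "(\<lambda>z. norm (v - z) powr \<alpha>) \<in> borel_measurable lebesgue" for v :: "real ^ 'n"
    using measurable_kernel(1)[of v \<alpha>] by (simp add: norm_minus_commute)
  have meas: "F1 \<in> borel_measurable lebesgue" "F2 \<in> borel_measurable lebesgue" "F3 \<in> borel_measurable lebesgue"
    unfolding F1_def F2_def F3_def by measurable
  have [measurable]: "K \<in> borel_measurable lebesgue"
    unfolding K_def by measurable
  have K: "integrable lebesgue K"
    unfolding K_def using r s p T by (intro majorant_integrable u) auto
  then have Kh: "integrable lebesgue (\<lambda>y. K (y + h))"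
    by (subst integral_shift) auto
  have K0: "0 \<le> K z" for z
    by (simp add: K_def majorant_nonneg)
  have K_eq: "K z = (T + \<bar>u z\<bar>) powr (p - 1) / norm (z - xo) powr \<alpha>" if "R / 2 \<le> norm (z - xo)" for z
    using that by (simp add: K_def majorant_def \<alpha> dist_norm norm_minus_commute)
  \<comment> \<open>Trades a distance \<open>D\<close> comparable to \<open>norm (z - xo)\<close> for a power of \<open>c\<close> and the majorant.\<close>
  have absorb: "B / D powr \<alpha> \<le> C / c powr \<alpha> * K z"
    if "B \<le> C * (T + \<bar>u z\<bar>) powr (p - 1)" "0 \<le> C" "c * norm (z - xo) \<le> D" "R / 2 \<le> norm (z - xo)" for B C D z
  proof -
    have pos: "0 < c * norm (z - xo)"
      using c0 that(4) r by (intro mult_pos_pos) linarith+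
    have "(c * norm (z - xo)) powr \<alpha> \<le> D powr \<alpha>"
      using pos that(3) \<alpha>0 by (intro powr_mono2) auto
    then have "B / D powr \<alpha> \<le> C * (T + \<bar>u z\<bar>) powr (p - 1) / (c * norm (z - xo)) powr \<alpha>"
      using pos that by (intro frac_le) auto
    also have "\<dots> = C / c powr \<alpha> * K z"
      using c0 by (simp add: K_eq[OF that(4)] powr_mult)
    finally show ?thesis .
  qed
  have V_le: "\<bar>V (p - 1) (b - u z)\<bar> \<le> 1 * (T + \<bar>u z\<bar>) powr (p - 1)" if "\<bar>b\<bar> \<le> T" for b z
    unfolding abs_V using that p by (simp, intro powr_mono2) auto
  have F1_le: "\<bar>F1 y\<bar> \<le> (p - 1) * \<bar>a' - a\<bar> / T / c powr \<alpha> * K (y + h)" for y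
  proof (cases "y \<in> ball xo R")
    case False
    let ?w = "T + \<bar>u (y + h)\<bar>"
    have "\<bar>V (p - 1) (a' - u (y + h)) - V (p - 1) (a - u (y + h))\<bar>
        \<le> (p - 1) * ?w powr (p - 1 - 1) * \<bar>(a' - u (y + h)) - (a - u (y + h))\<bar>"
      using p T by (intro V_diff_le) (auto simp: a_def a'_def)
    also have "\<dots> = (p - 1) * \<bar>a' - a\<bar> * ?w powr (p - 1 - 1)"
      by simp
    also have "\<dots> \<le> (p - 1) * \<bar>a' - a\<bar> * (?w powr (p - 1) / T)"
    proof (intro mult_left_mono)
      have "?w powr (p - 1 - 1) * T \<le> ?w powr (p - 1 - 1) * ?w"
        by (intro mult_left_mono) auto
      also have "\<dots> = ?w powr (p - 1)"
        using T powr_mult_base[of ?w "p - 1 - 1"] by (simp add: mult.commute)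
      finally show "?w powr (p - 1 - 1) \<le> ?w powr (p - 1) / T"
        using T by (simp add: field_simps)
    qed (use p in auto)
    finally have "\<bar>V (p - 1) (a' - u (y + h)) - V (p - 1) (a - u (y + h))\<bar>
        \<le> (p - 1) * \<bar>a' - a\<bar> / T * ?w powr (p - 1)"
      by simp
    from absorb[OF this _ dist_exterior_ge(2,3)[OF r x h False, folded c]] False p T
    show ?thesis
      by (simp add: F1_def)
  next
    case True
    then show ?thesis
      using K0[of "y + h"] p T by (simp add: F1_def)
  qed
  have F2_le: "\<bar>F2 (y + h)\<bar> \<le> 1 / c powr \<alpha> * K (y + h)" for y
  proof (cases "y \<in> ball xo R")
    case False
    from absorb[OF V_le _ dist_exterior_ge(2,3)[OF r x h False, folded c], of a] False T
    show ?thesis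
      by (simp add: F2_def a_def)
  next
    case True
    then show ?thesis
      using K0[of "y + h"] by (simp add: F2_def)
  qed
  have F3_le: "\<bar>F3 z\<bar> \<le> 1 / c powr \<alpha> * K z" for z
  proof (cases "z \<in> ball xo R")
    case False
    then have "R / 2 \<le> norm (z - xo)"
      using r by (simp add: dist_norm norm_minus_commute)
    from absorb[OF V_le _ dist_exterior_ge(1)[OF r x h False, folded c] this, of a] False T
    show ?thesis
      by (simp add: F3_def a_def)
  next
    case True
    then show ?thesis
      using K0[of z] by (simp add: F3_def)
  qed
  have I1: "integrable lebesgue F1"
    by (rule Bochner_Integration.integrable_bound[OF integrable_mult_right[OF Kh] meas(1)], rule AE_I2,
        unfold real_norm_def, rule order_trans[OF F1_le abs_ge_self])
  have I2h: "integrable lebesgue (\<lambda>y. F2 (y + h))"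
    by (rule Bochner_Integration.integrable_bound[OF integrable_mult_right[OF Kh] measurable_shift[OF meas(2)]], rule AE_I2,
        unfold real_norm_def, rule order_trans[OF F2_le abs_ge_self])
  then have I2: "integrable lebesgue F2"
    by (subst (asm) integral_shift(1)[OF meas(2)])
  have I3: "integrable lebesgue F3"
    by (rule Bochner_Integration.integrable_bound[OF integrable_mult_right[OF K] meas(3)], rule AE_I2,
        unfold real_norm_def, rule order_trans[OF F3_le abs_ge_self])
  have decomp: "(\<lambda>y. indicator (- ball xo R) y *\<^sub>R nonlocal_integrand s p u h x y)
      = (\<lambda>y. F1 y + (F2 (y + h) - F3 y))"
  proof
    fix y
    have "indicator (- ball (xo + h) R) (y + h) = (indicator (- ball xo R) y :: real)"
      by (simp add: indicator_def)
    then show "indicator (- ball xo R) y *\<^sub>R nonlocal_integrand s p u h x y = F1 y + (F2 (y + h) - F3 y)"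
      by (simp add: F1_def F2_def F3_def nonlocal_integrand_def shift_def a_def a'_def \<alpha>
          diff_divide_distrib algebra_simps)
  qed
  show "set_integrable lebesgue (- ball xo R) (nonlocal_integrand s p u h x)"
    unfolding set_integrable_def decomp using I1 I2h I3 by simp
  assume bounded: "AE z in lebesgue. z \<in> ball xo (R + norm h) \<longrightarrow> \<bar>u z\<bar> \<le> T"
  let ?C1 = "2 * \<alpha> * norm h / (R * c powr (\<alpha> + 1))" and ?C2 = "(2 / (c * R)) powr \<alpha>"
  let ?A = "ball xo (R + norm h) - ball xo (R - norm h)"
  have A: "?A \<in> lmeasurable"
    by (intro fmeasurable.Diff) auto
  then have A1: "integrable lebesgue (indicator ?A :: _ \<Rightarrow> real)"
    by (intro integrable_real_indicator) (auto simp: fmeasurable_def)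
  have G: "integrable lebesgue (\<lambda>z. ?C1 * K z + (2 * T) powr (p - 1) * ?C2 * indicator ?A z)"
    by (intro Bochner_Integration.integrable_add integrable_mult_right K A1)
  have "\<bar>LINT z|lebesgue. F2 z - F3 z\<bar>
      \<le> (LINT z|lebesgue. ?C1 * K z + (2 * T) powr (p - 1) * ?C2 * indicator ?A z)"
  proof (rule order_trans[OF integral_abs_bound])
    show "(LINT z|lebesgue. \<bar>F2 z - F3 z\<bar>)
      \<le> (LINT z|lebesgue. ?C1 * K z + (2 * T) powr (p - 1) * ?C2 * indicator ?A z)"
    proof (rule integral_mono_AE)
      show "AE z in lebesgue. \<bar>F2 z - F3 z\<bar> \<le> ?C1 * K z + (2 * T) powr (p - 1) * ?C2 * indicator ?A z"
        using bounded
      proof eventually_elim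
        case (elim z)
        let ?w = "(T + \<bar>u z\<bar>) powr (p - 1)"
        let ?k = "indicator (- ball (xo + h) R) z * (1 / norm (x + h - z) powr \<alpha>)
          - indicator (- ball xo R) z * (1 / norm (x - z) powr \<alpha>)"
        let ?b = "indicator (- ball xo (R / 2)) z * (1 / norm (z - xo) powr \<alpha>)"
        have "F2 z - F3 z = V (p - 1) (a - u z) * ?k"
          by (simp add: F2_def F3_def algebra_simps)
        then have "\<bar>F2 z - F3 z\<bar> = \<bar>V (p - 1) (a - u z)\<bar> * \<bar>?k\<bar>"
          by (simp only: abs_mult)
        also have "\<dots> \<le> ?w * (?C1 * ?b + ?C2 * indicator ?A z)"
          using V_le[of a z] T kernel_increment_le[OF r x h less_imp_le[OF \<alpha>0] c, of z]
          by (intro mult_mono) (auto simp: a_def)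
        also have "\<dots> = ?C1 * K z + ?w * (?C2 * indicator ?A z)"
          by (simp add: K_def majorant_def \<alpha> algebra_simps)
        also have "?w * (?C2 * indicator ?A z) \<le> (2 * T) powr (p - 1) * (?C2 * indicator ?A z)"
        proof (cases "z \<in> ?A")
          case True
          then have "?w \<le> (2 * T) powr (p - 1)"
            using elim p T by (intro powr_mono2) auto
          then show ?thesis
            by (intro mult_right_mono) auto
        qed simp
        finally show ?case
          by (simp add: mult_ac)
      qed
    qed (use I2 I3 G in auto)
  qed
  also have "\<dots> = ?C1 * J + (2 * T) powr (p - 1) * ?C2 * measure lebesgue ?A"
    by (subst Bochner_Integration.integral_add[OF integrable_mult_right[OF K] integrable_mult_right[OF A1]])
      (simp add: J flip: K_def)
  finally have second: "\<bar>LINT z|lebesgue. F2 z - F3 z\<bar>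
      \<le> ?C1 * J + (2 * T) powr (p - 1) * ?C2 * measure lebesgue ?A" .
  have "\<bar>LINT y|lebesgue. F1 y\<bar> \<le> (LINT y|lebesgue. (p - 1) * \<bar>a' - a\<bar> / T / c powr \<alpha> * K (y + h))"
    by (rule order_trans[OF integral_abs_bound]) (intro integral_mono integrable_abs I1 integrable_mult_right Kh F1_le)
  also have "\<dots> = (p - 1) * \<bar>a' - a\<bar> / T / c powr \<alpha> * J"
    using integral_shift(2)[of K h] by (simp add: J K_def[symmetric])
  finally have first: "\<bar>LINT y|lebesgue. F1 y\<bar> \<le> (p - 1) * \<bar>tau h u x\<bar> / (T * c powr \<alpha>) * J"
    by (simp add: tau_def a_def a'_def)
  have "(LINT y : - ball xo R | lebesgue. nonlocal_integrand s p u h x y)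
      = (LINT y|lebesgue. F1 y) + ((LINT y|lebesgue. F2 (y + h)) - (LINT z|lebesgue. F3 z))"
    unfolding set_lebesgue_integral_def decomp using I1 I2h I3 by simp
  also have "\<dots> = (LINT y|lebesgue. F1 y) + (LINT z|lebesgue. F2 z - F3 z)"
    using I2 I3 integral_shift(2)[OF meas(2), of h] by simp
  finally show "\<bar>LINT y : - ball xo R | lebesgue. nonlocal_integrand s p u h x y\<bar>
      \<le> (p - 1) * \<bar>tau h u x\<bar> / (T * c powr \<alpha>) * J
        + ?C1 * J + (2 * T) powr (p - 1) * ?C2 * measure lebesgue ?A"
    using first second by linarith
qed

section \<open>Explicit constants\<close>

definition majorant_const :: "'n::finite itself \<Rightarrow> real \<Rightarrow> real" where
  "majorant_const _ p = 2 powr (p - 1)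
    * (2 ^ CARD('n) * unit_ball_vol (CARD('n)) * 2 powr (p + 1) + 1)"

text \<open>
  Since \<open>s < 1\<close>, all powers with exponent \<open>s * p\<close> of the numerical factors are bounded in terms of \<open>p\<close>;
  only the sum of the geometric series contributes \<open>1 / s\<close>. The tail integral itself satisfies a bound
  without this factor, and \<open>1 \<le> 1 / s\<close> absorbs it.
\<close>

lemma majorant_integral_le_scale:
  fixes u :: "real ^ 'n \<Rightarrow> real"
  assumes u: "u \<in> L_sp s p" and s: "0 < s" "s < 1" and p: "2 \<le> p" and T: "0 \<le> T"
    and R: "0 < R" "R \<le> \<rho>"
    and bounded: "AE z in lebesgue. z \<in> ball xo \<rho> \<longrightarrow> \<bar>u z\<bar> \<le> T"
    and tail: "Tail s p u xo \<rho> \<le> T"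
  shows "(LINT z|lebesgue. majorant s p T u xo (R / 2) z)
    \<le> majorant_const TYPE('n) p / s * T powr (p - 1) / R powr (s * p)"
proof -
  let ?\<alpha> = "real CARD('n) + s * p"
  let ?q = "p - 1"
  let ?\<omega> = "unit_ball_vol (real CARD('n))"
  let ?B = "2 ^ CARD('n) * ?\<omega>"
  define Q where "Q = (LINT z|lebesgue. indicator (- ball xo \<rho>) z * (\<bar>u z\<bar> powr ?q / norm (z - xo) powr ?\<alpha>))"
  have Q0: "0 \<le> Q"
    unfolding Q_def by (intro integral_nonneg_AE) auto
  have "Tail s p u xo \<rho> = (\<rho> powr (s * p) * Q) powr (1 / ?q)"
    by (simp add: Tail_def set_lebesgue_integral_def Q_def)
  then have "((\<rho> powr (s * p) * Q) powr (1 / ?q)) powr ?q \<le> T powr ?q"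
    using tail p by (intro powr_mono2) auto
  then have "\<rho> powr (s * p) * Q \<le> T powr ?q"
    using p Q0 by (simp add: powr_powr)
  moreover have "R powr (s * p) * Q \<le> \<rho> powr (s * p) * Q"
    using R s p Q0 by (intro mult_right_mono powr_mono2) auto
  ultimately have "R powr (s * p) * Q \<le> T powr ?q"
    by linarith
  then have "Q \<le> T powr ?q / R powr (s * p)"
    using R by (simp add: field_simps)
  also have "\<dots> \<le> 1 / s * (T powr ?q / R powr (s * p))"
    using s mult_right_mono[of 1 "1 / s" "T powr ?q / R powr (s * p)"] by simp
  finally have Q: "Q \<le> 1 / s * (T powr ?q / R powr (s * p))" .
  have "s * 1 \<le> s * p"
    using s p by (intro mult_left_mono) auto
  then have half: "s / 2 \<le> 1 - 2 powr (- (s * p))"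
    using s by (intro one_minus_two_powr_ge) auto
  have scale: "(R / 2) powr (- (s * p)) = 2 powr (s * p) / R powr (s * p)"
    using R by (simp add: powr_minus_divide powr_divide)
  have "s * p \<le> 1 * p"
    using s p by (intro mult_right_mono) auto
  then have two: "2 powr (s * p) \<le> 2 powr p"
    by (intro powr_mono) auto
  have "?B * (R / 2) powr (- (s * p)) / (1 - 2 powr (- (s * p)))
      \<le> ?B * (2 powr p / R powr (s * p)) / (s / 2)"
    using s half two unfolding scale
    by (intro frac_le mult_left_mono divide_right_mono) auto
  also have "\<dots> = ?B * 2 powr (p + 1) / s / R powr (s * p)"
    by (simp add: powr_add mult_ac)
  finally have B: "?B * (R / 2) powr (- (s * p)) / (1 - 2 powr (- (s * p)))
      \<le> ?B * 2 powr (p + 1) / s / R powr (s * p)" .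
  have "(LINT z|lebesgue. majorant s p T u xo (R / 2) z)
      \<le> 2 powr ?q * (?B * (R / 2) powr (- (s * p)) / (1 - 2 powr (- (s * p))) * T powr ?q + Q)"
    unfolding Q_def using R by (intro majorant_integral_le u s(1) p T bounded) auto
  also have "\<dots> \<le> 2 powr ?q * (?B * 2 powr (p + 1) / s / R powr (s * p) * T powr ?q
      + 1 / s * (T powr ?q / R powr (s * p)))"
    using B Q by (intro mult_left_mono add_mono mult_right_mono) auto
  also have "\<dots> = majorant_const TYPE('n) p / s * T powr ?q / R powr (s * p)"
    by (simp add: majorant_const_def add_divide_distrib distrib_left distrib_right)
  finally show ?thesis .
qed

definition nonlocal_const :: "'n::finite itself \<Rightarrow> real \<Rightarrow> real" where
  "nonlocal_const n p =
     (p - 1) * 4 powr (real CARD('n) + p) * majorant_const n p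
     + 2 * (real CARD('n) + p) * 4 powr (real CARD('n) + p + 1) * majorant_const n p
     + 2 powr (p - 1) * 8 powr (real CARD('n) + p) * unit_ball_vol (CARD('n)) * CARD('n) * 2 ^ CARD('n)"

lemma majorant_const_pos: "0 < majorant_const TYPE('n::finite) p"
  by (simp add: majorant_const_def add_nonneg_pos)

lemma nonlocal_const_pos:
  assumes "2 \<le> p"
  shows "0 < nonlocal_const TYPE('n::finite) p"
  unfolding nonlocal_const_def using assms majorant_const_pos[where 'n='n, of p]
  by (intro add_pos_nonneg mult_pos_pos mult_nonneg_nonneg) auto

text \<open>
  With \<open>L = R / (R - r)\<close> one has \<open>1 / c = 4 * L\<close> and \<open>1 \<le> L\<close>. The three terms of
  \<open>nonlocal_increment_estimate\<close> become the three summands of the constant. The annulus term scales like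
  \<open>norm h * R powr (N - 1)\<close> times the maximal kernel \<open>(L / R) powr (N + s * p)\<close>, which is the same power of \<open>R\<close> as in
  the kernel difference and one power of \<open>L\<close> less.
\<close>

lemma nonlocal_increment_le:
  fixes u :: "real ^ 'n \<Rightarrow> real"
  assumes u: "u \<in> L_sp s p" and s: "0 < s" "s < 1" and p: "2 \<le> p"
    and r: "0 < r" "r < R" and x: "norm (x - xo) < (R + r) / 2"
    and h: "norm h \<le> d" and d: "d \<le> (R - r) / 4"
    and T: "0 < T" "\<bar>u x\<bar> \<le> T" "\<bar>u (x + h)\<bar> \<le> T"
    and bounded: "AE z in lebesgue. z \<in> ball xo (R + d) \<longrightarrow> \<bar>u z\<bar> \<le> T"
    and tail: "Tail s p u xo (R + d) \<le> T"
  shows "\<bar>LINT y : - ball xo R | lebesgue. nonlocal_integrand s p u h x y\<bar>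
    \<le> nonlocal_const TYPE('n) p / s * (\<bar>tau h u x\<bar> / R powr (s * p))
          * (R / (R - r)) powr (real CARD('n) + s * p) * T powr (p - 2)
      + nonlocal_const TYPE('n) p / s * (norm h / R powr (s * p + 1))
          * (R / (R - r)) powr (real CARD('n) + s * p + 1) * T powr (p - 1)"
proof -
  define N where "N = real CARD('n)"
  define \<alpha> where "\<alpha> = real CARD('n) + s * p"
  define c where "c = (R - r) / (4 * R)"
  define L where "L = R / (R - r)"
  define J where "J = (LINT z|lebesgue. majorant s p T u xo (R / 2) z)"
  define A where "A = majorant_const TYPE('n) p"
  define \<omega> where "\<omega> = unit_ball_vol (CARD('n))"
  define m where "m = measure lebesgue (ball xo (R + norm h) - ball xo (R - norm h))"
  define C1 C2 C3 where "C1 = (p - 1) * 4 powr (N + p) * A"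
    and "C2 = 2 * (N + p) * 4 powr (N + p + 1) * A"
    and "C3 = 2 powr (p - 1) * 8 powr (N + p) * \<omega> * N * 2 ^ CARD('n)"
  have C: "nonlocal_const TYPE('n) p = C1 + C2 + C3"
    by (simp add: nonlocal_const_def C1_def C2_def C3_def N_def A_def \<omega>_def)
  have A0: "0 < A"
    unfolding A_def by (rule majorant_const_pos)
  have N1: "1 \<le> N"
    by (simp add: N_def Suc_le_eq)
  have \<omega>0: "0 \<le> \<omega>"
    by (simp add: \<omega>_def)
  have C0: "0 \<le> C1" "0 \<le> C2" "0 \<le> C3"
    using A0 N1 \<omega>0 p by (auto simp: C1_def C2_def C3_def)
  have "s * p \<le> 1 * p"
    using s p by (intro mult_right_mono) auto
  then have \<alpha>: "0 \<le> \<alpha>" "\<alpha> \<le> N + p"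
    using s p by (auto simp: \<alpha>_def N_def)
  have L1: "1 \<le> L" and R0: "0 < R" and c0: "0 < c" and cL: "1 / c = 4 * L"
    using r by (auto simp: L_def c_def)
  have h4: "norm h \<le> (R - r) / 4"
    using h d by linarith
  have cpow: "1 / c powr \<beta> = 4 powr \<beta> * L powr \<beta>" for \<beta>
  proof -
    have "1 / c powr \<beta> = (1 / c) powr \<beta>"
      using c0 by (simp add: powr_divide)
    then show ?thesis
      using L1 by (simp add: cL powr_mult)
  qed
  have J: "J \<le> A / s * T powr (p - 1) / R powr (s * p)"
    unfolding J_def A_def using R0 T h norm_ge_zero[of h]
    by (intro majorant_integral_le_scale[OF u s p _ _ _ bounded tail]) linarith+
  have bounded': "AE z in lebesgue. z \<in> ball xo (R + norm h) \<longrightarrow> \<bar>u z\<bar> \<le> T"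
    using bounded by eventually_elim (use h in auto)
  have T2: "T powr (p - 1) / T = T powr (p - 2)"
    using T by (simp add: powr_diff field_simps power2_eq_square)
  have "(p - 1) * \<bar>tau h u x\<bar> / (T * c powr \<alpha>) * J
      = (p - 1) * \<bar>tau h u x\<bar> * (1 / T) * (1 / c powr \<alpha>) * J"
    by simp
  also have "\<dots> \<le> (p - 1) * \<bar>tau h u x\<bar> * (1 / T) * (4 powr (N + p) * L powr \<alpha>)
      * (A / s * T powr (p - 1) / R powr (s * p))"
    unfolding cpow using \<alpha> T p J
    by (intro mult_mono order_refl powr_mono mult_nonneg_nonneg) (auto simp: J_def majorant_nonneg)
  also have "\<dots> = C1 / s * (\<bar>tau h u x\<bar> / R powr (s * p)) * L powr \<alpha> * (T powr (p - 1) / T)"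
    by (simp add: C1_def mult_ac)
  also have "\<dots> \<le> (C1 + C2 + C3) / s * (\<bar>tau h u x\<bar> / R powr (s * p)) * L powr \<alpha> * (T powr (p - 1) / T)"
    using C0 s T by (intro mult_right_mono divide_right_mono) auto
  finally have term1: "(p - 1) * \<bar>tau h u x\<bar> / (T * c powr \<alpha>) * J
      \<le> (C1 + C2 + C3) / s * (\<bar>tau h u x\<bar> / R powr (s * p)) * L powr \<alpha> * T powr (p - 2)"
    unfolding T2 .
  have "2 * \<alpha> * norm h / (R * c powr (\<alpha> + 1)) * J
      = 2 * \<alpha> * norm h * (1 / R) * (1 / c powr (\<alpha> + 1)) * J"
    by simp
  also have "\<dots> \<le> 2 * (N + p) * norm h * (1 / R) * (4 powr (N + p + 1) * L powr (\<alpha> + 1))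
      * (A / s * T powr (p - 1) / R powr (s * p))"
    unfolding cpow using \<alpha> T p J R0
    by (intro mult_mono order_refl powr_mono mult_nonneg_nonneg) (auto simp: J_def majorant_nonneg)
  also have "\<dots> = C2 / s * (norm h / R powr (s * p + 1)) * L powr (\<alpha> + 1) * T powr (p - 1)"
    using R0 by (simp add: C2_def powr_add mult_ac)
  finally have term2: "2 * \<alpha> * norm h / (R * c powr (\<alpha> + 1)) * J
      \<le> C2 / s * (norm h / R powr (s * p + 1)) * L powr (\<alpha> + 1) * T powr (p - 1)" .
  have "m \<le> \<omega> * (N * (2 * R) powr (N - 1) * (2 * norm h))"
    unfolding m_def \<omega>_def N_def using content_annulus_le[of "norm h" R xo] h4 r by simp
  also have "\<dots> = \<omega> * N * 2 powr N * norm h * (R powr N / R)"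
    using R0 by (simp add: powr_mult powr_diff)
  finally have m: "m \<le> \<omega> * N * 2 ^ CARD('n) * norm h * (R powr N / R)"
    by (simp add: N_def powr_realpow)
  have "2 / (c * R) = 2 * (1 / c) / R"
    by simp
  then have "(2 / (c * R)) powr \<alpha> = (8 * L) powr \<alpha> / R powr \<alpha>"
    unfolding cL using R0 L1 by (simp add: powr_divide)
  also have "\<dots> = 8 powr \<alpha> * L powr \<alpha> / R powr \<alpha>"
    using L1 by (simp add: powr_mult)
  also have "\<dots> \<le> 8 powr (N + p) * L powr (\<alpha> + 1) / R powr \<alpha>"
    using L1 \<alpha> by (intro divide_right_mono mult_mono powr_mono) auto
  finally have ker: "(2 / (c * R)) powr \<alpha> \<le> 8 powr (N + p) * L powr (\<alpha> + 1) / R powr \<alpha>" .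
  have "(2 * T) powr (p - 1) * (2 / (c * R)) powr \<alpha> * m
      \<le> (2 * T) powr (p - 1) * (8 powr (N + p) * L powr (\<alpha> + 1) / R powr \<alpha>)
        * (\<omega> * N * 2 ^ CARD('n) * norm h * (R powr N / R))"
    using ker m by (intro mult_mono order_refl mult_nonneg_nonneg) (auto simp: m_def)
  also have "\<dots> = C3 * (norm h / R powr (s * p + 1)) * L powr (\<alpha> + 1) * T powr (p - 1)"
    using R0 T by (simp add: C3_def powr_mult powr_add \<alpha>_def N_def)
  also have "\<dots> \<le> C3 / s * (norm h / R powr (s * p + 1)) * L powr (\<alpha> + 1) * T powr (p - 1)"
    using C0 s mult_left_mono[of 1 "1 / s" C3] by (intro mult_right_mono) auto
  finally have term3: "(2 * T) powr (p - 1) * (2 / (c * R)) powr \<alpha> * m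
      \<le> C3 / s * (norm h / R powr (s * p + 1)) * L powr (\<alpha> + 1) * T powr (p - 1)" .
  let ?X = "norm h / R powr (s * p + 1) * L powr (\<alpha> + 1) * T powr (p - 1)"
  have "0 \<le> C1 / s * ?X"
    using C0 s R0 by (intro mult_nonneg_nonneg) auto
  then have "C2 / s * ?X + C3 / s * ?X \<le> (C1 + C2 + C3) / s * ?X"
    by (simp only: add_divide_distrib distrib_right)
  then have term23: "2 * \<alpha> * norm h / (R * c powr (\<alpha> + 1)) * J + (2 * T) powr (p - 1) * (2 / (c * R)) powr \<alpha> * m
      \<le> (C1 + C2 + C3) / s * (norm h / R powr (s * p + 1)) * L powr (\<alpha> + 1) * T powr (p - 1)"
    using term2 term3 by (simp only: mult.assoc)
  have "\<bar>LINT y : - ball xo R | lebesgue. nonlocal_integrand s p u h x y\<bar>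
      \<le> (p - 1) * \<bar>tau h u x\<bar> / (T * c powr \<alpha>) * J + 2 * \<alpha> * norm h / (R * c powr (\<alpha> + 1)) * J
        + (2 * T) powr (p - 1) * (2 / (c * R)) powr \<alpha> * m"
    unfolding m_def using bounded'
    by (intro nonlocal_increment_estimate(2)[OF u s(1) p r x h4 T]) (auto simp: c_def \<alpha>_def J_def)
  also have "\<dots> \<le> (C1 + C2 + C3) / s * (\<bar>tau h u x\<bar> / R powr (s * p)) * L powr \<alpha> * T powr (p - 2)
      + (C1 + C2 + C3) / s * (norm h / R powr (s * p + 1)) * L powr (\<alpha> + 1) * T powr (p - 1)"
    using term1 term23 by linarith
  finally show ?thesis
    unfolding C L_def \<alpha>_def .
qed

section \<open>Passing to the essential supremum\<close>

text \<open>
  The essential supremum over a ball of positive radius cannot be negative, since the ball is not a null set.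
\<close>

lemma Linf_norm_AE:
  fixes u :: "real ^ 'n \<Rightarrow> real"
  assumes "0 < \<rho>" and fin: "Linf_norm u (ball xo \<rho>) \<noteq> \<infinity>"
  defines "M \<equiv> real_of_ereal (Linf_norm u (ball xo \<rho>))"
  shows "AE z in lebesgue. z \<in> ball xo \<rho> \<longrightarrow> \<bar>u z\<bar> \<le> M" and "0 \<le> M"
proof -
  let ?B = "ball xo \<rho>"
  have "AE z in lebesgue_on ?B. ereal \<bar>u z\<bar> \<le> Linf_norm u ?B"
    unfolding Linf_norm_def by (rule esssup_AE)
  then have "AE z in lebesgue. z \<in> ?B \<longrightarrow> ereal \<bar>u z\<bar> \<le> Linf_norm u ?B"
    by (subst (asm) AE_restrict_space_iff) auto
  then show bound: "AE z in lebesgue. z \<in> ?B \<longrightarrow> \<bar>u z\<bar> \<le> M"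
  proof eventually_elim
    case (elim z)
    then show ?case
      using fin unfolding M_def by (cases "Linf_norm u ?B") auto
  qed
  show "0 \<le> M"
  proof (rule ccontr)
    assume "\<not> 0 \<le> M"
    with bound have "AE z in lebesgue. z \<notin> ?B"
      by (auto elim!: eventually_mono)
    then have "?B \<in> null_sets lebesgue"
      by (subst AE_iff_null_sets) auto
    then have "measure lborel ?B = 0"
      by (auto simp: null_sets_def measure_def)
    with assms(1) show False
      by simp
  qed
qed

theorem lemma3p1:
  fixes p :: real
  assumes "CARD('n::finite) \<ge> 2" and "p \<ge> 2"
  shows "\<exists>Ct > 0. \<forall>s :: real. 0 < s \<and> s < 1 \<longrightarrow>
    (\<forall>(u :: real ^ 'n \<Rightarrow> real) xo R r d h.
       u \<in> L_sp s p \<and> R > 0 \<and> 0 < r \<and> r < R \<and> 0 < d \<and> d \<le> (R - r) / 4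
       \<and> h \<noteq> 0 \<and> norm h \<le> d \<longrightarrow>
       (AE x in lebesgue. x \<in> ball xo ((R + r) / 2) \<longrightarrow>
          set_integrable lebesgue (- ball xo R) (nonlocal_integrand s p u h x) \<and>
          ereal \<bar>LINT y : - ball xo R | lebesgue. nonlocal_integrand s p u h x y\<bar>
            \<le> nonlocal_bound (Ct / s) s p u xo R r d h x))"
proof (intro exI conjI allI impI)
  show "0 < nonlocal_const TYPE('n) p"
    using assms by (intro nonlocal_const_pos)
next
  fix s :: real and u :: "real ^ 'n \<Rightarrow> real" and xo h :: "real ^ 'n" and R r d :: real
  assume "0 < s \<and> s < 1"
    and *: "u \<in> L_sp s p \<and> R > 0 \<and> 0 < r \<and> r < R \<and> 0 < d \<and> d \<le> (R - r) / 4
       \<and> h \<noteq> 0 \<and> norm h \<le> d"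
  then have s: "0 < s" "s < 1" and u: "u \<in> L_sp s p" and r: "0 < r" "r < R"
    and d: "0 < d" "d \<le> (R - r) / 4" and h: "norm h \<le> d"
    by auto
  let ?C = "nonlocal_const TYPE('n) p / s"
  \<comment> \<open>Integrability holds also if \<open>u\<close> is locally unbounded: \<open>T\<close> need only bound two values of \<open>u\<close>.\<close>
  have integrable: "set_integrable lebesgue (- ball xo R) (nonlocal_integrand s p u h x)"
    if "x \<in> ball xo ((R + r) / 2)" for x
    using that h d
    by (intro nonlocal_increment_estimate(1)[OF u s(1) assms(2) r, where T = "1 + \<bar>u x\<bar> + \<bar>u (x + h)\<bar>"])
      (auto simp: dist_norm norm_minus_commute)
  show "AE x in lebesgue. x \<in> ball xo ((R + r) / 2) \<longrightarrow>
          set_integrable lebesgue (- ball xo R) (nonlocal_integrand s p u h x) \<and>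
          ereal \<bar>LINT y : - ball xo R | lebesgue. nonlocal_integrand s p u h x y\<bar>
            \<le> nonlocal_bound ?C s p u xo R r d h x"
  proof (cases "Linf_norm u (ball xo (R + d)) = \<infinity>")
    case True
    with integrable show ?thesis
      by (simp add: nonlocal_bound_def)
  next
    case False
    define M where "M = real_of_ereal (Linf_norm u (ball xo (R + d)))"
    define T where "T = M + Tail s p u xo (R + d)"
    have M: "AE z in lebesgue. z \<in> ball xo (R + d) \<longrightarrow> \<bar>u z\<bar> \<le> M" "0 \<le> M"
      using Linf_norm_AE[OF _ False] r d unfolding M_def by auto
    have tail0: "0 \<le> Tail s p u xo (R + d)"
      by (simp add: Tail_def)
    have T: "0 \<le> T" "M \<le> T" "Tail s p u xo (R + d) \<le> T"
      using M tail0 by (auto simp: T_def)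
    show ?thesis
      using M(1) AE_shift[OF M(1), of h]
    proof eventually_elim
      case (elim x)
      show ?case
      proof (intro impI conjI integrable)
        assume x: "x \<in> ball xo ((R + r) / 2)"
        let ?I = "\<bar>LINT y : - ball xo R | lebesgue. nonlocal_integrand s p u h x y\<bar>"
        let ?E1 = "?C * (\<bar>tau h u x\<bar> / R powr (s * p)) * (R / (R - r)) powr (real CARD('n) + s * p)"
        let ?E2 = "?C * (norm h / R powr (s * p + 1)) * (R / (R - r)) powr (real CARD('n) + s * p + 1)"
        let ?P = "\<lambda>t. if p = 2 then 1 else t powr (p - 2)"
        have x': "norm (x - xo) < (R + r) / 2"
          using x by (simp add: dist_norm norm_minus_commute)
        have "x \<in> ball xo (R + d)"
          using x r d by auto
        then have ux: "\<bar>u x\<bar> \<le> M"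
          using elim by blast
        have "norm (x + h - xo) \<le> norm (x - xo) + norm h"
          using norm_triangle_ineq[of "x - xo" h] by (simp add: algebra_simps)
        then have "norm (x + h - xo) < R + d"
          using x' h r by argo
        then have uxh: "\<bar>u (x + h)\<bar> \<le> M"
          using elim by (simp add: dist_norm norm_minus_commute)
        \<comment> \<open>The estimate divides by \<open>T\<close>, which vanishes if \<open>u = 0\<close> almost everywhere; so it is applied to
          \<open>T + \<epsilon>\<close>, and the bound is continuous as \<open>\<epsilon>\<close> tends to zero from the right.\<close>
        have approx: "?I \<le> ?E1 * ?P (T + \<epsilon>) + ?E2 * (T + \<epsilon>) powr (p - 1)" if "0 < \<epsilon>" for \<epsilon>
        proof -
          have "AE z in lebesgue. z \<in> ball xo (R + d) \<longrightarrow> \<bar>u z\<bar> \<le> T + \<epsilon>"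
            using M(1) by eventually_elim (use T that in auto)
          then have "?I \<le> ?E1 * (T + \<epsilon>) powr (p - 2) + ?E2 * (T + \<epsilon>) powr (p - 1)"
            using ux uxh T that by (intro nonlocal_increment_le[OF u s assms(2) r x' h d(2)]) auto
          moreover have "(T + \<epsilon>) powr (p - 2) = ?P (T + \<epsilon>)"
            using T that by auto
          ultimately show ?thesis
            by simp
        qed
        have lim: "((\<lambda>\<epsilon>. T + \<epsilon>) \<longlongrightarrow> T) (at_right 0)"
          by (auto intro!: tendsto_eq_intros)
        have pos: "eventually (\<lambda>\<epsilon>. 0 \<le> T + \<epsilon>) (at_right 0)"
          using eventually_at_right_less[of 0] by eventually_elim (use T in auto)
        have "((\<lambda>\<epsilon>. ?P (T + \<epsilon>)) \<longlongrightarrow> ?P T) (at_right 0)"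
          using assms(2) pos by (auto intro!: tendsto_powr' lim)
        moreover have "((\<lambda>\<epsilon>. (T + \<epsilon>) powr (p - 1)) \<longlongrightarrow> T powr (p - 1)) (at_right 0)"
          using assms(2) pos by (auto intro!: tendsto_powr' lim)
        ultimately have "((\<lambda>\<epsilon>. ?E1 * ?P (T + \<epsilon>) + ?E2 * (T + \<epsilon>) powr (p - 1))
            \<longlongrightarrow> ?E1 * ?P T + ?E2 * T powr (p - 1)) (at_right 0)"
          by (intro tendsto_add tendsto_mult tendsto_const)
        then have "?I \<le> ?E1 * ?P T + ?E2 * T powr (p - 1)"
        proof (rule tendsto_lowerbound)
          show "eventually (\<lambda>\<epsilon>. ?I \<le> ?E1 * ?P (T + \<epsilon>) + ?E2 * (T + \<epsilon>) powr (p - 1)) (at_right 0)"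
            using eventually_at_right_less[of 0] by eventually_elim (rule approx)
        qed simp
        then show "ereal ?I \<le> nonlocal_bound ?C s p u xo R r d h x"
          using False by (simp only: nonlocal_bound_def if_False Let_def ereal_less_eq M_def[symmetric] T_def[symmetric])
      qed
    qed
  qed
qed

end
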